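(* Let $X$ be a separable infinite-dimensional $F$-space with $F$-norm $\|\cdot\|$, let $\Lambda\subset (0,+\infty)$ be a $\sigma$-compact set and let $\mathcal T=\{T_{\lambda,n}: n\in\mathbb N_0,\ \lambda\in\Lambda\}$ be a continuous family of operators acting on $X$, with $T_{\lambda,0}=\mathrm{Id}$ for all $\lambda\in\Lambda$. Assume that there are a non-decreasing function $F:\mathbb N\to(0,+\infty)$ with $\sum_{n\in\mathbb N}\frac1{F(n)}=+\infty$, a dense subset $\mathcal D\subset X$ and maps $S_{\lambda,n}:\mathcal D\to\mathcal D$, $n\in\mathbb N_0$, $\lambda\in\Lambda$, such that $T_{\lambda,n}\circ S_{\lambda,n}=\mathrm{Id}$ on $\mathcal D$ for all $\lambda\in\Lambda$, $n\in\mathbb N_0$ and, for all $u\in\mathcal D$ and all compact $K\subset\Lambda$, the following properties hold. (i) There exist $\kappa\in\mathbb N$ and a summable sequence of positive numbers $(c_k)_{k\in\mathbb N}$ such that, for all $\lambda,\mu\in K$: (a) $\|T_{\lambda,n+k}S_{\mu,n}u\|\le c_k$ for any $n\ge 0$, $k\ge\kappa$, whenever $\mu\le\lambda$; (b) $\|T_{\lambda,n}S_{\mu,n+k}u\|\le c_k$ for any $n\ge0$, $k\ge\kappa$, whenever $\lambda\le\mu$. (ii) Given $\eta>0$, one can find $\tau>0$ such that, for all $n\gg1$ and all $\lambda,\mu\in K$, $$0\le\mu-\lambda\le\frac{\tau}{F(n)}\ \Longrightarrow\ \|T_{\lambda,n}S_{\mu,n}u-u\|\le\eta .$$ Then the set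 of common universal vectors for $\mathcal T$ is a dense $G_\delta$ subset of $X$.
   Context: $\mathbb N_0=\mathbb N\cup\{0\}$. An operator on $X$ is a continuous linear map $X\to X$. The family $\{T_{\lambda,n}\}$ is a continuous family of operators if each $T_{\lambda,n}$ is an operator on $X$ and $(u,\lambda)\mapsto T_{\lambda,n}u$ is continuous from $X\times\Lambda$ to $X$ for every $n\in\mathbb N_0$. A vector $u\in X$ is universal for a sequence $(T_n)_{n\in\mathbb N_0}$ of operators if $\{T_nu:n\in\mathbb N_0\}$ is dense in $X$; a common universal vector for $\mathcal T$ is a vector universal for $(T_{\lambda,n})_{n\in\mathbb N_0}$ for every $\lambda\in\Lambda$. "For all $n\gg1$" means that there is $n_0\in\mathbb N$ such that the property holds for all $n\ge n_0$ (here $n_0$ does not depend on $\lambda,\mu$). *)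

theory Defs
  imports "HOL-Analysis.Analysis"
begin

text \<open>
  The scalar field is an arbitrary commutative real normed field \<open>'k\<close>. As the norm of a
  \<open>real_normed_field\<close> is multiplicative, the theorems of Gelfand-Mazur and Ostrowski say that
  \<open>'k\<close> is isometrically isomorphic to the reals or the complex numbers, so real and complex
  F-spaces are covered, and nothing else.
\<close>

locale F_norm = vector_space smul
  for smul :: "'k::real_normed_field \<Rightarrow> 'a::ab_group_add \<Rightarrow> 'a" +
  fixes fnorm :: "'a \<Rightarrow> real"
  assumes fnorm_nonneg: "0 \<le> fnorm u"
    and fnorm_triangle: "fnorm (u + v) \<le> fnorm u + fnorm v"
    and fnorm_scale_le: "norm a \<le> 1 \<Longrightarrow> fnorm (smul a u) \<le> fnorm u"
    and fnorm_scale_tendsto: "((\<lambda>a. fnorm (smul a u)) \<longlongrightarrow> 0) (at 0)"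
    and fnorm_eq_0D: "fnorm u = 0 \<Longrightarrow> u = 0"

text \<open>
  The metric, hence the topology, of the type \<open>'a\<close> is the one induced by the F-norm; it is complete
  by the type class \<open>complete_space\<close>.
\<close>

locale F_space = F_norm smul fnorm
  for smul :: "'k::real_normed_field \<Rightarrow> 'a::{ab_group_add, complete_space} \<Rightarrow> 'a"
    and fnorm :: "'a \<Rightarrow> real" +
  assumes dist_fnorm: "dist u v = fnorm (u - v)"

lemma F_space_banach: "F_space scaleR (norm :: 'a::banach \<Rightarrow> real)"
proof unfold_locales
  fix u :: 'a
  have "((\<lambda>a. norm (a *\<^sub>R u)) \<longlongrightarrow> norm ((0::real) *\<^sub>R u)) (at 0)"
    by (intro tendsto_intros)
  then show "((\<lambda>a. norm (a *\<^sub>R u)) \<longlongrightarrow> 0) (at (0::real))"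
    by simp
qed (auto simp: algebra_simps norm_triangle_ineq dist_norm mult_left_le_one_le)

definition infinite_dimensional :: "('k::field \<Rightarrow> 'a::ab_group_add \<Rightarrow> 'a) \<Rightarrow> bool" where
  "infinite_dimensional smul \<longleftrightarrow> \<not> (\<exists>B. finite_dimensional_vector_space smul B)"

definition sigma_compact :: "'a::topological_space set \<Rightarrow> bool" where
  "sigma_compact A \<longleftrightarrow> (\<exists>K :: nat \<Rightarrow> 'a set. (\<forall>n. compact (K n)) \<and> A = (\<Union>n. K n))"

definition dense :: "'a::topological_space set \<Rightarrow> bool" where
  "dense A \<longleftrightarrow> closure A = UNIV"

definition operator_on ::
  "('k::field \<Rightarrow> 'a::{ab_group_add, topological_space} \<Rightarrow> 'a) \<Rightarrow> ('a \<Rightarrow> 'a) \<Rightarrow> bool" where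
  "operator_on smul f \<longleftrightarrow> Vector_Spaces.linear smul smul f \<and> continuous_on UNIV f"

definition continuous_family ::
  "('k::field \<Rightarrow> 'a::{ab_group_add, topological_space} \<Rightarrow> 'a) \<Rightarrow> 'l::topological_space set
    \<Rightarrow> ('l \<Rightarrow> nat \<Rightarrow> 'a \<Rightarrow> 'a) \<Rightarrow> bool" where
  "continuous_family smul \<Lambda> T \<longleftrightarrow>
    (\<forall>l\<in>\<Lambda>. \<forall>n. operator_on smul (T l n)) \<and>
    (\<forall>n. continuous_on (UNIV \<times> \<Lambda>) (\<lambda>(u, l). T l n u))"

definition universal_vector :: "(nat \<Rightarrow> 'a \<Rightarrow> 'a) \<Rightarrow> 'a::topological_space \<Rightarrow> bool" where
  "universal_vector T u \<longleftrightarrow> dense {T n u | n. True}"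

definition common_universal_vectors ::
  "'l set \<Rightarrow> ('l \<Rightarrow> nat \<Rightarrow> 'a \<Rightarrow> 'a) \<Rightarrow> 'a::topological_space set" where
  "common_universal_vectors \<Lambda> T = {u. \<forall>l\<in>\<Lambda>. universal_vector (T l) u}"

end

theory Submission
  imports Defs
begin

text \<open>
  The proof is a Baire category argument, built on the construction that Costakis and Sambarino
  used for common hypercyclic vectors. By \<open>\<sigma>\<close>-compactness of \<open>\<Lambda>\<close> and separability of the space,
  the set of common universal vectors is a countable intersection of sets of the form
  \<open>{u. \<forall>l\<in>K. \<exists>n. T l n u \<in> V}\<close>, where \<open>K \<subseteq> \<Lambda>\<close> is compact and \<open>V\<close> is a ball
  (\<open>common_universal_vectors_eq_INT\<close>). Such a set is open by the tube lemma
  (\<open>open_hitting_set\<close>), and everything comes down to its density: given \<open>w\<close> and \<open>v\<close> in the dense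
  set \<open>D\<close>, a vector \<open>u\<close> close to \<open>w\<close> is needed whose orbit, for every parameter in \<open>K\<close>, passes
  close to \<open>v\<close> (\<open>nearby_vector_hits_for_all_parameters\<close>).

  For this, fix a large \<open>N\<close>, use only the times \<open>i * N\<close>, and set
  \<open>u = w + (\<Sum>i. S (\<nu> i) (i * N) v)\<close> with increasing parameters \<open>\<nu> i \<in> K\<close>. By (ii), the \<open>i\<close>-th
  summand serves at time \<open>i * N\<close> all parameters in \<open>K\<close> that lie below \<open>\<nu> i\<close> at distance at most
  \<open>\<tau> / F (i * N)\<close>. As \<open>F\<close> is non-decreasing, the divergence of \<open>\<Sum> 1 / F n\<close> passes to
  \<open>\<Sum> 1 / F (i * N)\<close>, so finitely many such pieces cover \<open>K\<close> (\<open>compact_ordered_net\<close>).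
  For \<open>l\<close> in the \<open>i\<close>-th piece, the order of the pieces decides which half of (i) controls the other
  summands at time \<open>i * N\<close>: those with \<open>j < i\<close> have \<open>\<nu> j \<le> l\<close> and fall under (a), those with
  \<open>j > i\<close> have \<open>l \<le> \<nu> j\<close> and fall under (b). The total error is a sum of \<open>c k\<close> over
  \<open>k \<ge> N\<close>, which is small. The term \<open>w\<close> also falls under (a), because \<open>T l 0 = id\<close> forces
  \<open>S l 0 w = w\<close>; and \<open>u\<close> is close to \<open>w\<close> by (b) at time \<open>0\<close>.
\<close>

section \<open>Sums and partitions of the parameter set\<close>

lemma summable_uniformly_small_tails:
  fixes c :: "nat \<Rightarrow> real"
  assumes pos: "\<And>k. k \<ge> 1 \<Longrightarrow> c k > 0" and c: "summable (\<lambda>k. c (Suc k))" and "\<epsilon> > 0"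
  shows "\<exists>N. \<forall>A. finite A \<longrightarrow> A \<subseteq> {N..} \<longrightarrow> sum c A \<le> \<epsilon>"
proof -
  have "summable c"
    using c by (simp add: summable_Suc_iff)
  then obtain N where N: "\<And>m n. m \<ge> N \<Longrightarrow> norm (sum c {m..<n}) < \<epsilon>"
    using \<open>\<epsilon> > 0\<close> unfolding summable_Cauchy by meson
  have "sum c A \<le> \<epsilon>" if A: "finite A" "A \<subseteq> {Suc N..}" for A
  proof -
    have "A \<subseteq> {Suc N..<Suc (Max A)}"
      using A by (auto simp: less_Suc_eq_le)
    then have "sum c A \<le> sum c {Suc N..<Suc (Max A)}"
      using pos by (intro sum_mono2) (auto simp: less_imp_le)
    then show ?thesis
      using N[of "Suc N" "Suc (Max A)"] by simp
  qed
  then show ?thesis by blast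
qed

text \<open>
  The errors that the pieces before, respectively after, the \<open>i\<close>-th one contribute at time
  \<open>i * N\<close>. The lags \<open>\<bar>i - j\<bar> * N\<close> are distinct and at least \<open>N\<close>, so each sum is part of
  the tail of \<open>c\<close>.
\<close>

lemma sum_spaced_differences_le:
  fixes c :: "nat \<Rightarrow> real"
  assumes tail: "\<And>A. finite A \<Longrightarrow> A \<subseteq> {N..} \<Longrightarrow> sum c A \<le> \<epsilon>" and "N \<ge> 1" "finite J"
  shows "(\<Sum>j\<in>{j\<in>J. j < i}. c ((i - j) * N)) \<le> \<epsilon>"
    and "(\<Sum>j\<in>{j\<in>J. i < j}. c ((j - i) * N)) \<le> \<epsilon>"
proof -
  have "inj_on (\<lambda>j. (i - j) * N) {j\<in>J. j < i}"
    using \<open>N \<ge> 1\<close> by (auto simp: inj_on_def)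
  then have "(\<Sum>j\<in>{j\<in>J. j < i}. c ((i - j) * N)) = sum c ((\<lambda>j. (i - j) * N) ` {j\<in>J. j < i})"
    by (simp add: sum.reindex)
  also have "\<dots> \<le> \<epsilon>"
    using \<open>finite J\<close> by (intro tail) auto
  finally show "(\<Sum>j\<in>{j\<in>J. j < i}. c ((i - j) * N)) \<le> \<epsilon>" .
  have "inj_on (\<lambda>j. (j - i) * N) {j\<in>J. i < j}"
    using \<open>N \<ge> 1\<close> by (auto simp: inj_on_def)
  then have "(\<Sum>j\<in>{j\<in>J. i < j}. c ((j - i) * N)) = sum c ((\<lambda>j. (j - i) * N) ` {j\<in>J. i < j})"
    by (simp add: sum.reindex)
  also have "\<dots> \<le> \<epsilon>"
    using \<open>finite J\<close> by (intro tail) auto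
  finally show "(\<Sum>j\<in>{j\<in>J. i < j}. c ((j - i) * N)) \<le> \<epsilon>" .
qed

text \<open>
  Each block of \<open>N\<close> consecutive terms is at most \<open>N\<close> times its first term, so a bound on the sums
  along the multiples of \<open>N\<close> would bound all partial sums.
\<close>

lemma sum_along_multiples_unbounded:
  fixes f :: "nat \<Rightarrow> real"
  assumes pos: "\<And>n. n \<ge> 1 \<Longrightarrow> f n > 0" and anti: "\<And>m n. 1 \<le> m \<Longrightarrow> m \<le> n \<Longrightarrow> f n \<le> f m"
    and div: "filterlim (\<lambda>n. \<Sum>k=1..n. f k) at_top sequentially" and "N \<ge> 1"
  shows "\<exists>p. (\<Sum>i=1..p. f (i * N)) > B"
proof (rule ccontr)
  assume "\<not> ?thesis"
  then have B: "(\<Sum>i=1..p. f (i * N)) \<le> B" for p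
    by (simp add: not_less)
  have block: "sum f {1..<(p + 1) * N} \<le> sum f {1..<N} + N * (\<Sum>i=1..p. f (i * N))" for p
  proof (induction p)
    case (Suc p)
    have "sum f {(p + 1) * N..<(p + 2) * N} \<le> of_nat (card {(p + 1) * N..<(p + 2) * N}) * f ((p + 1) * N)"
      using \<open>N \<ge> 1\<close> by (intro sum_bounded_above anti) (auto simp: Suc_le_eq)
    also have "\<dots> = N * f ((p + 1) * N)"
      by (simp add: algebra_simps)
    finally have *: "sum f {(p + 1) * N..<(p + 2) * N} \<le> N * f ((p + 1) * N)" .
    have "sum f {1..<(p + 2) * N} = sum f {1..<(p + 1) * N} + sum f {(p + 1) * N..<(p + 2) * N}"
      using \<open>N \<ge> 1\<close> by (intro sum.atLeastLessThan_concat [symmetric]) (auto simp: Suc_le_eq)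
    then show ?case
      using Suc * by (simp add: algebra_simps)
  qed simp
  obtain n where n: "(\<Sum>k=1..n. f k) > sum f {1..<N} + N * B"
    using div unfolding filterlim_at_top_dense eventually_sequentially by blast
  have "n < (n + 1) * N"
    using \<open>N \<ge> 1\<close> by (cases N) auto
  then have "(\<Sum>k=1..n. f k) \<le> sum f {1..<(n + 1) * N}"
    using pos by (intro sum_mono2) (auto simp: less_imp_le)
  also have "\<dots> \<le> sum f {1..<N} + N * B"
    using block[of n] B[of n] mult_left_mono[OF B[of n], of "real N"] by simp
  finally show False
    using n by simp
qed

text \<open>
  If \<open>a\<close> lies below \<open>K\<close>, then finitely many of the cells
  \<open>(a + \<delta> 1 + \<dots> + \<delta> (i - 1), a + \<delta> 1 + \<dots> + \<delta> i]\<close> cover \<open>K\<close>.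
  Taking the largest point of \<open>K\<close> in each cell that meets \<open>K\<close>, rather than the end of the cell,
  keeps the chosen parameters in \<open>K\<close>, which may have gaps.
\<close>

lemma compact_ordered_net:
  fixes K :: "real set" and \<delta> :: "nat \<Rightarrow> real"
  assumes "compact K" and \<delta>: "\<And>i. i \<ge> 1 \<Longrightarrow> \<delta> i > 0"
    and unbounded: "\<And>B. \<exists>p. (\<Sum>i=1..p. \<delta> i) > B"
  shows "\<exists>J \<nu>. finite J \<and> J \<subseteq> {1..} \<and> \<nu> ` J \<subseteq> K \<and>
           (\<forall>x\<in>K. \<exists>i\<in>J. x \<le> \<nu> i \<and> \<nu> i - x \<le> \<delta> i \<and>
              (\<forall>j\<in>J. (j < i \<longrightarrow> \<nu> j \<le> x) \<and> (i < j \<longrightarrow> x \<le> \<nu> j)))"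
proof -
  obtain a where a: "\<And>x. x \<in> K \<Longrightarrow> \<bar>x\<bar> < a"
    using compact_imp_bounded[OF \<open>compact K\<close>] by (auto simp: bounded_pos_less)
  define t where "t i = (\<Sum>k=1..i. \<delta> k) - a" for i
  have t_Suc: "t (Suc i) = t i + \<delta> (Suc i)" for i
    by (simp add: t_def)
  have t_mono: "t i \<le> t j" if "i \<le> j" for i j
    using that by (rule lift_Suc_mono_le[rotated]) (simp add: t_Suc \<delta> less_imp_le)
  obtain p where p: "t p > a"
    using unbounded[of "2 * a"] by (auto simp: t_def)
  define cell where "cell i = K \<inter> {t (i - 1)<..t i}" for i
  define J where "J = {i\<in>{1..p}. cell i \<noteq> {}}"
  have "\<exists>m\<in>cell i. \<forall>x\<in>cell i. x \<le> m" if nonempty: "cell i \<noteq> {}" for i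
  proof -
    obtain y where y: "y \<in> cell i"
      using nonempty by blast
    have "compact (K \<inter> {y..t i})"
      using \<open>compact K\<close> by (intro compact_Int_closed) auto
    moreover have "y \<in> K \<inter> {y..t i}"
      using y by (auto simp: cell_def)
    ultimately obtain m where m: "m \<in> K \<inter> {y..t i}" "\<And>x. x \<in> K \<inter> {y..t i} \<Longrightarrow> x \<le> m"
      using compact_attains_sup[of "K \<inter> {y..t i}"] by blast
    have "x \<le> m" if "x \<in> cell i" for x
      using m(1) m(2)[of x] that by (cases "y \<le> x") (auto simp: cell_def)
    moreover have "m \<in> cell i"
      using m(1) y by (auto simp: cell_def)
    ultimately show ?thesis
      by blast
  qed
  then obtain \<nu> where \<nu>: "\<And>i. cell i \<noteq> {} \<Longrightarrow> \<nu> i \<in> cell i \<and> (\<forall>x\<in>cell i. x \<le> \<nu> i)"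
    by metis
  have "\<exists>i\<in>J. x \<le> \<nu> i \<and> \<nu> i - x \<le> \<delta> i \<and>
          (\<forall>j\<in>J. (j < i \<longrightarrow> \<nu> j \<le> x) \<and> (i < j \<longrightarrow> x \<le> \<nu> j))" if "x \<in> K" for x
  proof -
    define i where "i = (LEAST i. x \<le> t i)"
    have "x \<le> t p"
      using a[OF \<open>x \<in> K\<close>] p by linarith
    then have "i \<le> p" and xi: "x \<le> t i"
      unfolding i_def by (auto intro: Least_le LeastI)
    have "t 0 < x"
      using a[OF \<open>x \<in> K\<close>] by (simp add: t_def)
    then have "i \<noteq> 0"
      using xi by (metis not_less)
    then have "\<not> x \<le> t (i - 1)"
      unfolding i_def by (intro not_less_Least) auto
    then have x: "x \<in> cell i"
      using xi \<open>x \<in> K\<close> by (simp add: cell_def)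
    then have \<nu>i: "\<nu> i \<in> cell i" "x \<le> \<nu> i"
      using \<nu>[of i] by auto
    have "\<nu> i - x \<le> \<delta> i"
      using x \<nu>i t_Suc[of "i - 1"] \<open>i \<noteq> 0\<close> by (simp add: cell_def)
    moreover have "\<nu> j \<le> x" if "j \<in> J" "j < i" for j
    proof -
      have "\<nu> j \<le> t j"
        using \<nu>[of j] that by (auto simp: J_def cell_def)
      also have "\<dots> \<le> t (i - 1)"
        using that by (intro t_mono) simp
      finally show ?thesis
        using x by (simp add: cell_def)
    qed
    moreover have "x \<le> \<nu> j" if "j \<in> J" "i < j" for j
    proof -
      have "x \<le> t (j - 1)"
        using xi t_mono[of i "j - 1"] that by linarith
      also have "\<dots> \<le> \<nu> j"
        using \<nu>[of j] that by (auto simp: J_def cell_def)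
      finally show ?thesis .
    qed
    moreover have "i \<in> J"
      using x \<open>i \<le> p\<close> \<open>i \<noteq> 0\<close> by (auto simp: J_def)
    ultimately show ?thesis
      using \<nu>i by blast
  qed
  moreover have "finite J" "J \<subseteq> {1..}"
    by (auto simp: J_def)
  moreover have "\<nu> ` J \<subseteq> K"
    using \<nu> by (auto simp: J_def cell_def)
  ultimately show ?thesis
    by blast
qed

section \<open>Hitting a vector along a compact set of parameters\<close>

lemma (in F_space) fnorm_sum_le: "fnorm (sum f A) \<le> (\<Sum>x\<in>A. fnorm (f x))"
proof (induction A rule: infinite_finite_induct)
  case (insert x A)
  then show ?case
    using fnorm_triangle[of "f x" "sum f A"] by simp
qed (use dist_fnorm[of 0 0] in auto)

text \<open>
  At time \<open>i * N\<close> four errors of size \<open>\<epsilon>\<close> occur: from \<open>w\<close>, from \<open>S (\<nu> i) (i * N) v\<close> not being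
  the exact right inverse at the parameter \<open>l\<close>, and from the summands before and after the \<open>i\<close>-th.
\<close>

lemma (in F_space) nearby_vector_hits_for_all_parameters:
  fixes T S :: "real \<Rightarrow> nat \<Rightarrow> 'a \<Rightarrow> 'a" and F :: "nat \<Rightarrow> real"
  assumes "compact K"
    and linear: "\<And>l n. l \<in> K \<Longrightarrow> Vector_Spaces.linear smul smul (T l n)"
    and T0: "\<And>l. l \<in> K \<Longrightarrow> T l 0 = id"
    and F_pos: "\<And>n. n \<ge> 1 \<Longrightarrow> F n > 0" and F_mono: "mono_on {1..} F"
    and F_div: "filterlim (\<lambda>N. \<Sum>n=1..N. 1 / F n) at_top sequentially"
    and "N \<ge> 1" "\<tau> > 0"
    and tail: "\<And>A. finite A \<Longrightarrow> A \<subseteq> {N..} \<Longrightarrow> sum c A \<le> \<epsilon>"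
    and vanish: "\<And>l k. l \<in> K \<Longrightarrow> k \<ge> N \<Longrightarrow> fnorm (T l k w) \<le> \<epsilon>"
    and later: "\<And>l m n k. l \<in> K \<Longrightarrow> m \<in> K \<Longrightarrow> m \<le> l \<Longrightarrow> k \<ge> N \<Longrightarrow> fnorm (T l (n + k) (S m n v)) \<le> c k"
    and earlier: "\<And>l m n k. l \<in> K \<Longrightarrow> m \<in> K \<Longrightarrow> l \<le> m \<Longrightarrow> k \<ge> N \<Longrightarrow> fnorm (T l n (S m (n + k) v)) \<le> c k"
    and close: "\<And>l m n. l \<in> K \<Longrightarrow> m \<in> K \<Longrightarrow> n \<ge> N \<Longrightarrow> 0 \<le> m - l \<Longrightarrow> m - l \<le> \<tau> / F n \<Longrightarrow>
                  fnorm (T l n (S m n v) - v) \<le> \<epsilon>"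
  shows "\<exists>u. fnorm (u - w) \<le> \<epsilon> \<and> (\<forall>l\<in>K. \<exists>n. fnorm (T l n u - v) \<le> 4 * \<epsilon>)"
proof -
  have unbounded: "\<exists>p. (\<Sum>i=1..p. \<tau> / F (i * N)) > B" for B
  proof -
    have "\<exists>p. (\<Sum>i=1..p. 1 / F (i * N)) > B / \<tau>"
    proof (rule sum_along_multiples_unbounded[where f = "\<lambda>n. 1 / F n"])
      show "1 / F n \<le> 1 / F m" if "1 \<le> m" "m \<le> n" for m n
        using that F_pos F_mono by (intro divide_left_mono) (auto simp: mono_on_def)
    qed (use F_pos F_div \<open>N \<ge> 1\<close> in auto)
    then obtain p where "(\<Sum>i=1..p. 1 / F (i * N)) > B / \<tau>" ..
    then have "\<tau> * (\<Sum>i=1..p. 1 / F (i * N)) > B"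
      using \<open>\<tau> > 0\<close> by (simp add: field_simps)
    then show ?thesis
      by (auto simp: sum_distrib_left)
  qed
  have step_pos: "\<tau> / F (i * N) > 0" if "i \<ge> 1" for i
    using F_pos[of "i * N"] that \<open>N \<ge> 1\<close> \<open>\<tau> > 0\<close> by (auto simp: Suc_le_eq)
  obtain J \<nu> where J: "finite J" "J \<subseteq> {1..}" "\<nu> ` J \<subseteq> K"
    and net: "\<forall>x\<in>K. \<exists>i\<in>J. x \<le> \<nu> i \<and> \<nu> i - x \<le> \<tau> / F (i * N) \<and>
              (\<forall>j\<in>J. (j < i \<longrightarrow> \<nu> j \<le> x) \<and> (i < j \<longrightarrow> x \<le> \<nu> j))"
    using compact_ordered_net[OF \<open>compact K\<close> step_pos unbounded] by blast
  define g where "g j = S (\<nu> j) (j * N) v" for j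
  define u where "u = w + sum g J"
  have "fnorm (u - w) \<le> (\<Sum>j\<in>J. fnorm (g j))"
    using fnorm_sum_le[of g J] by (simp add: u_def)
  \<comment> \<open>At time \<open>0\<close> every summand is a later one, since \<open>T l 0\<close> is the identity and \<open>0 \<notin> J\<close>.\<close>
  also have "\<dots> \<le> (\<Sum>j\<in>{j\<in>J. 0 < j}. c ((j - 0) * N))"
  proof -
    have "fnorm (g j) \<le> c (j * N)" if "j \<in> J" for j
      using earlier[of "\<nu> j" "\<nu> j" "j * N" 0] that J T0[of "\<nu> j"] by (force simp: g_def)
    moreover have "{j\<in>J. 0 < j} = J"
      using J by auto
    ultimately show ?thesis
      by (simp add: sum_mono)
  qed
  also have "\<dots> \<le> \<epsilon>"
    using tail \<open>N \<ge> 1\<close> J(1) by (rule sum_spaced_differences_le)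
  finally have "fnorm (u - w) \<le> \<epsilon>" .
  moreover have "\<exists>n. fnorm (T l n u - v) \<le> 4 * \<epsilon>" if "l \<in> K" for l
  proof -
    obtain i where i: "i \<in> J" "l \<le> \<nu> i" "\<nu> i - l \<le> \<tau> / F (i * N)"
      and before: "\<And>j. j \<in> J \<Longrightarrow> j < i \<Longrightarrow> \<nu> j \<le> l"
      and after: "\<And>j. j \<in> J \<Longrightarrow> i < j \<Longrightarrow> l \<le> \<nu> j"
      using bspec[OF net \<open>l \<in> K\<close>] by blast
    have iN: "i * N \<ge> N"
      using i J by auto
    interpret Tl: Vector_Spaces.linear smul smul "T l (i * N)"
      using linear \<open>l \<in> K\<close> by blast
    let ?h = "\<lambda>j. T l (i * N) (g j)"
    let ?B = "{j\<in>J. j < i}" and ?A = "{j\<in>J. i < j}"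
    have "J = insert i (?B \<union> ?A)"
      using i by auto
    then have "sum ?h J = sum ?h (insert i (?B \<union> ?A))"
      by simp
    also have "\<dots> = ?h i + (sum ?h ?B + sum ?h ?A)"
      using J by (subst sum.insert) (auto intro!: sum.union_disjoint)
    finally have "T l (i * N) u = T l (i * N) w + (?h i + (sum ?h ?B + sum ?h ?A))"
      by (simp add: u_def Tl.add Tl.sum)
    then have split: "T l (i * N) u - v = T l (i * N) w + ((?h i - v) + (sum ?h ?B + sum ?h ?A))"
      by (simp add: algebra_simps)
    have *: "fnorm (T l (i * N) u - v) \<le>
        fnorm (T l (i * N) w) + fnorm (?h i - v) + fnorm (sum ?h ?B) + fnorm (sum ?h ?A)"
      unfolding split
      using fnorm_triangle[of "T l (i * N) w" "(?h i - v) + (sum ?h ?B + sum ?h ?A)"]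
        fnorm_triangle[of "?h i - v" "sum ?h ?B + sum ?h ?A"]
        fnorm_triangle[of "sum ?h ?B" "sum ?h ?A"]
      by linarith
    have "fnorm (T l (i * N) w) \<le> \<epsilon>"
      using vanish \<open>l \<in> K\<close> iN by blast
    moreover have "fnorm (?h i - v) \<le> \<epsilon>"
      unfolding g_def using close[of l "\<nu> i" "i * N"] i \<open>l \<in> K\<close> iN J by auto
    moreover have "fnorm (sum ?h ?B) \<le> \<epsilon>"
    proof -
      have "fnorm (?h j) \<le> c ((i - j) * N)" if "j \<in> ?B" for j
      proof -
        have "(i - j) * N \<ge> N" "j * N + (i - j) * N = i * N"
          using that by (auto simp: Suc_le_eq simp flip: add_mult_distrib)
        then show ?thesis
          using later[of l "\<nu> j" "(i - j) * N" "j * N"] that before[of j] \<open>l \<in> K\<close> J(3)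
          by (simp add: g_def image_subset_iff)
      qed
      then have "fnorm (sum ?h ?B) \<le> (\<Sum>j\<in>?B. c ((i - j) * N))"
        by (rule order_trans[OF fnorm_sum_le sum_mono])
      also have "\<dots> \<le> \<epsilon>"
        using tail \<open>N \<ge> 1\<close> J(1) by (rule sum_spaced_differences_le)
      finally show ?thesis .
    qed
    moreover have "fnorm (sum ?h ?A) \<le> \<epsilon>"
    proof -
      have "fnorm (?h j) \<le> c ((j - i) * N)" if "j \<in> ?A" for j
      proof -
        have "(j - i) * N \<ge> N" "i * N + (j - i) * N = j * N"
          using that by (auto simp: Suc_le_eq simp flip: add_mult_distrib)
        then show ?thesis
          using earlier[of l "\<nu> j" "(j - i) * N" "i * N"] that after[of j] \<open>l \<in> K\<close> J(3)
          by (simp add: g_def image_subset_iff)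
      qed
      then have "fnorm (sum ?h ?A) \<le> (\<Sum>j\<in>?A. c ((j - i) * N))"
        by (rule order_trans[OF fnorm_sum_le sum_mono])
      also have "\<dots> \<le> \<epsilon>"
        using tail \<open>N \<ge> 1\<close> J(1) by (rule sum_spaced_differences_le)
      finally show ?thesis .
    qed
    ultimately show ?thesis
      using * by (intro exI[of _ "i * N"]) linarith
  qed
  ultimately show ?thesis
    by blast
qed

section \<open>Baire category\<close>

text \<open>
  The pairs \<open>(u, l)\<close> with a visit to \<open>V\<close> form an open set, and a slice \<open>{u} \<times> K\<close> inside it is
  contained in a tube \<open>U \<times> K\<close>; compactness of \<open>K\<close> is what makes \<open>U\<close> independent of the parameter.
\<close>

lemma open_hitting_set:
  fixes T :: "'l::topological_space \<Rightarrow> nat \<Rightarrow> 'a::topological_space \<Rightarrow> 'a"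
  assumes "compact K" "open V" and cont: "\<And>n. continuous_on (UNIV \<times> K) (\<lambda>(u, l). T l n u)"
  shows "open {u. \<forall>l\<in>K. \<exists>n. T l n u \<in> V}"
proof (subst open_subopen, clarify)
  fix u assume u: "\<forall>l\<in>K. \<exists>n. T l n u \<in> V"
  have "\<exists>W. open W \<and> W \<inter> UNIV \<times> K = (\<lambda>(u, l). T l n u) -` V \<inter> UNIV \<times> K" for n
    using cont[of n] \<open>open V\<close> by (simp add: continuous_on_open_invariant)
  then obtain W where W: "\<And>n. open (W n)"
    "\<And>n. W n \<inter> UNIV \<times> K = (\<lambda>(u, l). T l n u) -` V \<inter> UNIV \<times> K"
    by metis
  have mem: "(x, l) \<in> W n \<longleftrightarrow> T l n x \<in> V" if "l \<in> K" for x l n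
    using W(2)[of n] that by auto
  have "{u} \<times> K \<subseteq> (\<Union>n. W n)"
    using u mem by auto
  then obtain U where "u \<in> U" "open U" "U \<times> K \<subseteq> (\<Union>n. W n)"
    using Elementary_Topology.tube_lemma[OF \<open>compact K\<close>, of "\<Union>n. W n" u] W(1) by blast
  then show "\<exists>U. open U \<and> u \<in> U \<and> U \<subseteq> {u. \<forall>l\<in>K. \<exists>n. T l n u \<in> V}"
    using mem by (intro exI[of _ U]) blast
qed

lemma dense_gdelta_Inter:
  fixes \<G> :: "'a::complete_space set set"
  assumes "countable \<G>" "\<G> \<noteq> {}" and G: "\<And>V. V \<in> \<G> \<Longrightarrow> open V \<and> dense V"
  shows "dense (\<Inter>\<G>) \<and> gdelta (\<Inter>\<G>)"
proof
  show "dense (\<Inter>\<G>)"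
    using Baire_category[of euclidean \<G>] G \<open>countable \<G>\<close> completely_metrizable_space_euclidean
    by (auto simp: dense_def)
  have "gdelta (\<Inter>n. from_nat_into \<G> n)"
    using G from_nat_into[OF \<open>\<G> \<noteq> {}\<close>] by (intro gdelta.intros) blast
  then show "gdelta (\<Inter>\<G>)"
    using assms by (simp add: range_from_nat_into)
qed

lemma dense_iff_balls: "dense A \<longleftrightarrow> (\<forall>x. \<forall>\<epsilon>>0. \<exists>y\<in>A. dist y x < \<epsilon>)"
proof -
  have "dense A \<longleftrightarrow> (\<forall>x. x \<in> closure A)"
    unfolding dense_def by blast
  then show ?thesis
    by (simp only: closure_approachable)
qed

text \<open>
  Density of the orbits need only be tested on the balls of radius \<open>1 / (real r + 1)\<close> about the
  points of a dense set. For a countable \<open>C\<close> this turns common universality into countably many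
  conditions, each of which concerns one compact piece of the parameter set.
\<close>

lemma common_universal_vectors_eq_INT:
  fixes T :: "'l \<Rightarrow> nat \<Rightarrow> 'a::metric_space \<Rightarrow> 'a"
  assumes "dense C"
  shows "common_universal_vectors (\<Union>m. K m) T =
           (\<Inter>m. \<Inter>c\<in>C. \<Inter>r::nat. {u. \<forall>l\<in>K m. \<exists>n. T l n u \<in> ball c (1 / (real r + 1))})"
proof -
  have orbit: "universal_vector (T l) u \<longleftrightarrow> (\<forall>x. \<forall>\<epsilon>>0. \<exists>n. dist (T l n u) x < \<epsilon>)" for l u
    unfolding universal_vector_def dense_iff_balls by blast
  have "universal_vector (T l) u \<longleftrightarrow>
      (\<forall>c\<in>C. \<forall>r::nat. \<exists>n. T l n u \<in> ball c (1 / (real r + 1)))" for l u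
  proof
    assume "universal_vector (T l) u"
    moreover have "1 / (real r + 1) > 0" for r
      by simp
    ultimately have "\<exists>n. dist (T l n u) c < 1 / (real r + 1)" for c r
      unfolding orbit by blast
    then show "\<forall>c\<in>C. \<forall>r::nat. \<exists>n. T l n u \<in> ball c (1 / (real r + 1))"
      by (simp add: dist_commute)
  next
    assume R: "\<forall>c\<in>C. \<forall>r::nat. \<exists>n. T l n u \<in> ball c (1 / (real r + 1))"
    have "\<exists>n. dist (T l n u) x < \<epsilon>" if "\<epsilon> > 0" for x \<epsilon>
    proof -
      obtain r :: nat where r: "1 / (real r + 1) < \<epsilon> / 2"
        using reals_Archimedean[of "\<epsilon> / 2"] \<open>\<epsilon> > 0\<close> by (auto simp: inverse_eq_divide add.commute)
      obtain c where c: "c \<in> C" "dist c x < \<epsilon> / 2"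
        using \<open>dense C\<close> \<open>\<epsilon> > 0\<close> unfolding dense_iff_balls by (meson half_gt_zero)
      obtain n where "T l n u \<in> ball c (1 / (real r + 1))"
        using R c by blast
      then show ?thesis
        using r c dist_triangle[of "T l n u" x c] by (intro exI[of _ n]) (auto simp: dist_commute)
    qed
    then show "universal_vector (T l) u"
      unfolding orbit by blast
  qed
  then show ?thesis
    unfolding common_universal_vectors_def by auto
qed

theorem theorem2p1:
  fixes smul :: "'k::real_normed_field \<Rightarrow> 'a::{ab_group_add, complete_space} \<Rightarrow> 'a"
    and fnorm :: "'a \<Rightarrow> real"
    and \<Lambda> :: "real set"
    and T :: "real \<Rightarrow> nat \<Rightarrow> 'a \<Rightarrow> 'a"
    and S :: "real \<Rightarrow> nat \<Rightarrow> 'a \<Rightarrow> 'a"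
    and F :: "nat \<Rightarrow> real"
    and D :: "'a set"
  assumes "F_space smul fnorm"
    and "separable_space (euclidean :: 'a topology)"
    and "infinite_dimensional smul"
    and "\<Lambda> \<subseteq> {0<..}" and "sigma_compact \<Lambda>"
    and "continuous_family smul \<Lambda> T"
    and "\<And>l. l \<in> \<Lambda> \<Longrightarrow> T l 0 = id"
    and "\<And>n. n \<ge> 1 \<Longrightarrow> F n > 0" and "mono_on {1..} F"
    and "filterlim (\<lambda>N. \<Sum>n=1..N. 1 / F n) at_top sequentially"
    and "dense D"
    and "\<And>l n u. l \<in> \<Lambda> \<Longrightarrow> u \<in> D \<Longrightarrow> S l n u \<in> D"
    and "\<And>l n u. l \<in> \<Lambda> \<Longrightarrow> u \<in> D \<Longrightarrow> T l n (S l n u) = u"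
    and "\<And>u K. u \<in> D \<Longrightarrow> compact K \<Longrightarrow> K \<subseteq> \<Lambda> \<Longrightarrow>
           \<exists>\<kappa>\<ge>1. \<exists>c :: nat \<Rightarrow> real. (\<forall>k\<ge>1. c k > 0) \<and> summable (\<lambda>k. c (Suc k)) \<and>
             (\<forall>l\<in>K. \<forall>m\<in>K.
               (m \<le> l \<longrightarrow> (\<forall>n. \<forall>k\<ge>\<kappa>. fnorm (T l (n + k) (S m n u)) \<le> c k)) \<and>
               (l \<le> m \<longrightarrow> (\<forall>n. \<forall>k\<ge>\<kappa>. fnorm (T l n (S m (n + k) u)) \<le> c k)))"
    and "\<And>u K \<eta>. u \<in> D \<Longrightarrow> compact K \<Longrightarrow> K \<subseteq> \<Lambda> \<Longrightarrow> \<eta> > 0 \<Longrightarrow>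
           \<exists>\<tau>>0. \<forall>\<^sub>F n in sequentially. \<forall>l\<in>K. \<forall>m\<in>K.
             0 \<le> m - l \<and> m - l \<le> \<tau> / F n \<longrightarrow> fnorm (T l n (S m n u) - u) \<le> \<eta>"
  shows "dense (common_universal_vectors \<Lambda> T) \<and> gdelta (common_universal_vectors \<Lambda> T)"
proof -
  interpret F_space smul fnorm by fact
  have linear: "Vector_Spaces.linear smul smul (T l n)" if "l \<in> \<Lambda>" for l n
    using \<open>continuous_family smul \<Lambda> T\<close> that by (simp add: continuous_family_def operator_on_def)
  obtain K where K: "\<And>m::nat. compact (K m)" and \<Lambda>: "\<Lambda> = (\<Union>m. K m)"
    using \<open>sigma_compact \<Lambda>\<close> by (auto simp: sigma_compact_def)
  obtain C :: "'a set" where "countable C" "dense C"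
    using \<open>separable_space euclidean\<close> by (auto simp: separable_space_def dense_def)
  define decays where "decays m u N c \<longleftrightarrow>
      (\<forall>l\<in>K m. \<forall>\<mu>\<in>K m. \<forall>n. \<forall>k\<ge>N.
         (\<mu> \<le> l \<longrightarrow> fnorm (T l (n + k) (S \<mu> n u)) \<le> c k) \<and>
         (l \<le> \<mu> \<longrightarrow> fnorm (T l n (S \<mu> (n + k) u)) \<le> c k))" for m u N and c :: "nat \<Rightarrow> real"
  \<comment> \<open>Condition (i) with \<open>\<kappa>\<close> enlarged so far that the tail of \<open>c\<close> is small.\<close>
  have decay: "\<exists>N\<ge>1. \<exists>c. (\<forall>A. finite A \<longrightarrow> A \<subseteq> {N..} \<longrightarrow> sum c A \<le> \<epsilon>) \<and> decays m u N c"
    if "u \<in> D" "\<epsilon> > 0" for u m \<epsilon>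
  proof -
    have "K m \<subseteq> \<Lambda>"
      using \<Lambda> by blast
    from assms(14)[OF \<open>u \<in> D\<close> K this]
    obtain \<kappa> c where "\<kappa> \<ge> 1" and c: "\<forall>k\<ge>1. c k > 0" "summable (\<lambda>k. c (Suc k))"
      and est: "\<forall>l\<in>K m. \<forall>\<mu>\<in>K m.
               (\<mu> \<le> l \<longrightarrow> (\<forall>n. \<forall>k\<ge>\<kappa>. fnorm (T l (n + k) (S \<mu> n u)) \<le> c k)) \<and>
               (l \<le> \<mu> \<longrightarrow> (\<forall>n. \<forall>k\<ge>\<kappa>. fnorm (T l n (S \<mu> (n + k) u)) \<le> c k))"
      by blast
    obtain N where N: "\<And>A. finite A \<Longrightarrow> A \<subseteq> {N..} \<Longrightarrow> sum c A \<le> \<epsilon>"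
      using summable_uniformly_small_tails[of c \<epsilon>] c \<open>\<epsilon> > 0\<close> by blast
    have "sum c A \<le> \<epsilon>" if "finite A" "A \<subseteq> {max \<kappa> N..}" for A
      using that by (intro N) auto
    then show ?thesis
      using est \<open>\<kappa> \<ge> 1\<close> unfolding decays_def
      by (intro exI[of _ "max \<kappa> N"] conjI exI[of _ c]) auto
  qed
  \<comment> \<open>One \<open>N\<close> that is large enough for \<open>w\<close> and \<open>v\<close> in (i) and for \<open>v\<close> in (ii).\<close>
  have hit: "\<exists>u. dist u w \<le> \<epsilon> \<and> (\<forall>l\<in>K m. \<exists>n. dist (T l n u) v \<le> 4 * \<epsilon>)"
    if wv: "w \<in> D" "v \<in> D" and "\<epsilon> > 0" for w v \<epsilon> m
  proof -
    have sub: "K m \<subseteq> \<Lambda>"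
      using \<Lambda> by blast
    obtain N1 c1 where N1: "N1 \<ge> 1" "\<And>A. finite A \<Longrightarrow> A \<subseteq> {N1..} \<Longrightarrow> sum c1 A \<le> \<epsilon>"
      "decays m w N1 c1"
      using decay[OF \<open>w \<in> D\<close> \<open>\<epsilon> > 0\<close>, of m] by blast
    obtain N2 c where N2: "N2 \<ge> 1" "\<And>A. finite A \<Longrightarrow> A \<subseteq> {N2..} \<Longrightarrow> sum c A \<le> \<epsilon>"
      "decays m v N2 c"
      using decay[OF \<open>v \<in> D\<close> \<open>\<epsilon> > 0\<close>, of m] by blast
    obtain \<tau> N3 where "\<tau> > 0" and N3: "\<And>l \<mu> n. n \<ge> N3 \<Longrightarrow> l \<in> K m \<Longrightarrow> \<mu> \<in> K m \<Longrightarrow>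
        0 \<le> \<mu> - l \<Longrightarrow> \<mu> - l \<le> \<tau> / F n \<Longrightarrow> fnorm (T l n (S \<mu> n v) - v) \<le> \<epsilon>"
      using assms(15)[OF \<open>v \<in> D\<close> K sub \<open>\<epsilon> > 0\<close>] unfolding eventually_sequentially by blast
    define N where "N = max N1 (max N2 N3)"
    have vanish: "fnorm (T l k w) \<le> \<epsilon>" if "l \<in> K m" "k \<ge> N" for l k
    proof -
      have "S l 0 w = w"
        using assms(13)[of l w 0] assms(7)[of l] \<open>w \<in> D\<close> that sub by auto
      then have "fnorm (T l k w) \<le> c1 k"
        using N1(3) that unfolding decays_def N_def by (metis add_0 max.bounded_iff order_refl)
      also have "\<dots> \<le> \<epsilon>"
        using N1(2)[of "{k}"] that by (simp add: N_def)
      finally show ?thesis .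
    qed
    have later: "fnorm (T l (n + k) (S \<mu> n v)) \<le> c k" if "l \<in> K m" "\<mu> \<in> K m" "\<mu> \<le> l" "k \<ge> N" for l \<mu> n k
      using N2(3) that by (simp add: decays_def N_def)
    have earlier: "fnorm (T l n (S \<mu> (n + k) v)) \<le> c k" if "l \<in> K m" "\<mu> \<in> K m" "l \<le> \<mu>" "k \<ge> N" for l \<mu> n k
      using N2(3) that by (simp add: decays_def N_def)
    have close: "fnorm (T l n (S \<mu> n v) - v) \<le> \<epsilon>"
      if "l \<in> K m" "\<mu> \<in> K m" "n \<ge> N" "0 \<le> \<mu> - l" "\<mu> - l \<le> \<tau> / F n" for l \<mu> n
      using N3[of n l \<mu>] that by (simp add: N_def)
    have tail: "sum c A \<le> \<epsilon>" if "finite A" "A \<subseteq> {N..}" for A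
      using that by (intro N2(2)) (auto simp: N_def)
    have N: "N \<ge> 1"
      using N1(1) by (simp add: N_def)
    have K_facts: "Vector_Spaces.linear smul smul (T l n)" "T l 0 = id" if "l \<in> K m" for l n
      using linear assms(7) sub that by auto
    have "\<exists>u. fnorm (u - w) \<le> \<epsilon> \<and> (\<forall>l\<in>K m. \<exists>n. fnorm (T l n u - v) \<le> 4 * \<epsilon>)"
      by (rule nearby_vector_hits_for_all_parameters[where N = N and c = c and \<tau> = \<tau> and F = F and S = S])
        (rule K K_facts assms(8,9,10) N \<open>\<tau> > 0\<close> tail vanish later earlier close; assumption)+
    then show ?thesis
      by (simp add: dist_fnorm)
  qed
  define G where "G m x r = {u. \<forall>l\<in>K m. \<exists>n. T l n u \<in> ball x (1 / (real r + 1))}" for m x and r :: nat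
  have G_dense: "dense (G m x r)" for m x r
    unfolding dense_iff_balls
  proof clarify
    fix y and \<epsilon> :: real assume "\<epsilon> > 0"
    define \<rho> :: real where "\<rho> = 1 / (real r + 1)"
    have "\<rho> > 0"
      by (simp add: \<rho>_def)
    \<comment> \<open>The orbit comes within \<open>4 * \<eta>\<close> of \<open>v\<close>, which is \<open>\<eta>\<close>-close to the centre \<open>x\<close>.\<close>
    obtain \<eta> where \<eta>: "\<eta> > 0" "\<eta> < \<epsilon> / 2" "\<eta> < \<rho> / 5"
      using field_lbound_gt_zero[of "\<epsilon> / 2" "\<rho> / 5"] \<open>\<epsilon> > 0\<close> \<open>\<rho> > 0\<close> by auto
    obtain w v where wv: "w \<in> D" "v \<in> D" "dist w y < \<eta>" "dist v x < \<eta>"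
      using \<open>dense D\<close> \<eta> unfolding dense_iff_balls by meson
    obtain u where u: "dist u w \<le> \<eta>" "\<forall>l\<in>K m. \<exists>n. dist (T l n u) v \<le> 4 * \<eta>"
      using hit[OF wv(1,2) \<eta>(1)] by blast
    have "T l n u \<in> ball x \<rho>" if "dist (T l n u) v \<le> 4 * \<eta>" for l n
      using that wv \<eta> dist_triangle[of "T l n u" x v] by (simp add: dist_commute)
    then have "u \<in> G m x r"
      using u unfolding G_def \<rho>_def by blast
    moreover have "dist u y < \<epsilon>"
      using u wv \<eta> dist_triangle[of u y w] by linarith
    ultimately show "\<exists>u\<in>G m x r. dist u y < \<epsilon>"
      by blast
  qed
  have G_open: "open (G m x r)" for m x r
    unfolding G_def
  proof (rule open_hitting_set)
    fix n
    have "continuous_on (UNIV \<times> \<Lambda>) (\<lambda>(u, l). T l n u)"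
      using \<open>continuous_family smul \<Lambda> T\<close> by (simp add: continuous_family_def)
    then show "continuous_on (UNIV \<times> K m) (\<lambda>(u, l). T l n u)"
      by (rule continuous_on_subset) (auto simp: \<Lambda>)
  qed (use K in auto)
  let ?\<G> = "(\<lambda>(m, x, r). G m x r) ` (UNIV \<times> C \<times> UNIV)"
  have "common_universal_vectors \<Lambda> T = \<Inter>?\<G>"
    unfolding \<Lambda> common_universal_vectors_eq_INT[OF \<open>dense C\<close>] G_def by auto
  moreover have "dense (\<Inter>?\<G>) \<and> gdelta (\<Inter>?\<G>)"
  proof (rule dense_gdelta_Inter)
    show "countable ?\<G>"
      using \<open>countable C\<close> by simp
    show "?\<G> \<noteq> {}"
      using \<open>dense C\<close> by (auto simp: dense_def)
  qed (use G_dense G_open in auto)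
  ultimately show ?thesis
    by simp
qed

end
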